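(* The DAGs returned by the algorithm $\mathrm{dpll}_f$ (exhaustive DPLL, defined in the context), over all input CNF formulas and all possible choices of branching variables, form exactly the language of reduced FBDDs. That is: (i) for every CNF formula $\Delta$ and every execution of $\mathrm{dpll}_f(\Delta)$, the returned DAG is a reduced FBDD; and (ii) for every reduced FBDD $G$ there exist a CNF formula $\Delta$ and an execution of $\mathrm{dpll}_f(\Delta)$ whose returned DAG is isomorphic to $G$ (by an isomorphism preserving labels and the low/high distinction of children).
   Context: Fix a countably infinite set of propositional variables. A literal is $x$ or $\neg x$ for a variable $x$; a clause is a finite set (disjunction) of literals, possibly empty; a CNF formula is a finite set (conjunction) of clauses. The variables of $\Delta$ are those occurring in its clauses. For $b\in\{0,1\}$, $\Delta|_{x=b}$ is the CNF formula obtained from $\Delta$ by replacing $x$ with $b$: every clause containing a literal that evaluates to $1$ is removed, and every literal that evaluates to $0$ is deleted from the remaining clauses. **FBDD.** A decision diagram is a finite rooted DAG, all of whose nodes are reachable from the root, in which each node is either a sink labeled $0$ or $1$ (the 0-sink, the 1-sink) or a decision node labeled with a variable $x$ and having two designated children, a low child $\beta$ and a high child $\alpha$; such a node stands for the circuit $(x\wedge\alpha)\vee(\neg x\wedge\beta)$. An FBDD (free binary decision diagram) is a decision diagram in which every variable labels at most one node on any root-to-sink path (test-once property, equivalently decomposability of the conjunctions). It is reduced if (a) there is at most one 0-sink and at most one 1-sink, and no two distinct decision nodes have the same label, the same low child and the same high child; and (b) no decision node has identical low and high children. **Algorithm $\mathrm{dpll}_f(\Delta)$.** 1. If $\Delta$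 contains the empty clause, return the 0-sink. 2. If there are no variables in $\Delta$, return the 1-sink. 3. Select (nondeterministically, arbitrarily and possibly differently in each call) a variable $x$ of $\Delta$. 4. Return $\text{get-node}(x,\ \mathrm{dpll}_f(\Delta|_{x=0}),\ \mathrm{dpll}_f(\Delta|_{x=1}))$. There is a single 0-sink and a single 1-sink. The function $\text{get-node}(x,\mathit{low},\mathit{high})$ uses a global table of nodes (the unique-nodes table, initially empty, shared by all recursive calls of an execution): if $\mathit{low}$ and $\mathit{high}$ are the same node, it returns that node; otherwise, if a decision node labeled $x$ with low child $\mathit{low}$ and high child $\mathit{high}$ is already in the table, it returns that node; otherwise it creates such a node, stores it in the table, and returns it. The DAG returned by an execution is the DAG of all nodes reachable from the returned node. *)

theory Defs
  imports Main
begin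

type_synonym var = nat

datatype lit = Pos var | Neg var

type_synonym clause = "lit set"

definition is_cnf :: "clause set \<Rightarrow> bool" where
  "is_cnf \<Delta> \<longleftrightarrow> finite \<Delta> \<and> (\<forall>C\<in>\<Delta>. finite C)"

definition vars :: "clause set \<Rightarrow> var set" where
  "vars \<Delta> = {x. \<exists>C\<in>\<Delta>. Pos x \<in> C \<or> Neg x \<in> C}"

text \<open>The literal over \<open>x\<close> that evaluates to true when \<open>x\<close> is replaced with \<open>b\<close>.\<close>

definition true_lit :: "var \<Rightarrow> bool \<Rightarrow> lit" where
  "true_lit x b = (if b then Pos x else Neg x)"

definition condition :: "clause set \<Rightarrow> var \<Rightarrow> bool \<Rightarrow> clause set" where
  "condition \<Delta> x b = {C - {true_lit x (\<not> b)} | C. C \<in> \<Delta> \<and> true_lit x b \<notin> C}"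


text \<open>\<open>Decision x l h\<close> is a decision on \<open>x\<close> with low child \<open>l\<close> and high child \<open>h\<close>.\<close>

datatype 'n node = Sink bool | Decision var 'n 'n
  for map: map_node

text \<open>Only the values of \<open>kind\<close> on \<open>nodes\<close> are meaningful.\<close>

record 'n diagram =
  nodes :: "'n set"
  root :: 'n
  kind :: "'n \<Rightarrow> 'n node"

definition child :: "('n \<Rightarrow> 'n node) \<Rightarrow> 'n \<Rightarrow> 'n \<Rightarrow> bool" where
  "child k u v \<longleftrightarrow> (\<exists>x w. k u = Decision x v w \<or> k u = Decision x w v)"

definition decision_diagram :: "'n diagram \<Rightarrow> bool" where
  "decision_diagram G \<longleftrightarrow>
     finite (nodes G) \<and>
     root G \<in> nodes G \<and>
     (\<forall>u\<in>nodes G. \<forall>v. child (kind G) u v \<longrightarrow> v \<in> nodes G) \<and>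
     acyclic {(u, v). u \<in> nodes G \<and> child (kind G) u v} \<and>
     (\<forall>v\<in>nodes G. (child (kind G))\<^sup>*\<^sup>* (root G) v)"

definition root_sink_path :: "'n diagram \<Rightarrow> 'n list \<Rightarrow> bool" where
  "root_sink_path G p \<longleftrightarrow>
     p \<noteq> [] \<and> hd p = root G \<and> successively (child (kind G)) p \<and>
     (\<exists>b. kind G (last p) = Sink b)"

definition fbdd :: "'n diagram \<Rightarrow> bool" where
  "fbdd G \<longleftrightarrow>
     decision_diagram G \<and>
     (\<forall>p. root_sink_path G p \<longrightarrow>
        (\<forall>u\<in>set p. \<forall>v\<in>set p. \<forall>x l h l' h'.
           kind G u = Decision x l h \<and> kind G v = Decision x l' h' \<longrightarrow> u = v))"

text \<open>Equality of kinds covers both sinks with the same label and decision nodes with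
  the same variable, low child and high child.\<close>

definition reduced :: "'n diagram \<Rightarrow> bool" where
  "reduced G \<longleftrightarrow>
     (\<forall>u\<in>nodes G. \<forall>v\<in>nodes G. kind G u = kind G v \<longrightarrow> u = v) \<and>
     (\<forall>u\<in>nodes G. \<forall>x l h. kind G u = Decision x l h \<longrightarrow> l \<noteq> h)"

text \<open>\<open>map_node f\<close> keeps sink labels and variables, and applies \<open>f\<close> to the low and the high
  child separately.\<close>

definition isomorphic :: "'n diagram \<Rightarrow> 'm diagram \<Rightarrow> bool" where
  "isomorphic G H \<longleftrightarrow>
     (\<exists>f. bij_betw f (nodes G) (nodes H) \<and> f (root G) = root H \<and>
          (\<forall>u\<in>nodes G. kind H (f u) = map_node f (kind G u)))"


text \<open>A node of an execution is one of the two global sinks or an index into the unique-nodes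
  table. The table lists the created decision nodes in order of creation, so a new node gets
  the current length of the table as its index.\<close>

datatype ref = SinkRef bool | TableRef nat

type_synonym table = "(var \<times> ref \<times> ref) list"

text \<open>\<open>get_node x low high T n T'\<close>: called with table \<open>T\<close>, the function returns \<open>n\<close> and leaves
  the table \<open>T'\<close>.\<close>

inductive get_node :: "var \<Rightarrow> ref \<Rightarrow> ref \<Rightarrow> table \<Rightarrow> ref \<Rightarrow> table \<Rightarrow> bool" where
  same: "get_node x n n T n T"
| found: "low \<noteq> high \<Longrightarrow> i < length T \<Longrightarrow> T ! i = (x, low, high) \<Longrightarrow>
    get_node x low high T (TableRef i) T"
| fresh: "low \<noteq> high \<Longrightarrow> (x, low, high) \<notin> set T \<Longrightarrow>
    get_node x low high T (TableRef (length T)) (T @ [(x, low, high)])"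

text \<open>\<open>dpll_f \<Delta> T n T'\<close>: some execution on \<open>\<Delta>\<close>, started with table \<open>T\<close>, returns \<open>n\<close> and leaves
  the table \<open>T'\<close>. The low call is executed before the high call.\<close>

inductive dpll_f :: "clause set \<Rightarrow> table \<Rightarrow> ref \<Rightarrow> table \<Rightarrow> bool" where
  unsat: "{} \<in> \<Delta> \<Longrightarrow> dpll_f \<Delta> T (SinkRef False) T"
| sat: "{} \<notin> \<Delta> \<Longrightarrow> vars \<Delta> = {} \<Longrightarrow> dpll_f \<Delta> T (SinkRef True) T"
| branch: "{} \<notin> \<Delta> \<Longrightarrow> x \<in> vars \<Delta> \<Longrightarrow>
    dpll_f (condition \<Delta> x False) T low T1 \<Longrightarrow>
    dpll_f (condition \<Delta> x True) T1 high T2 \<Longrightarrow>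
    get_node x low high T2 n T3 \<Longrightarrow>
    dpll_f \<Delta> T n T3"

fun table_kind :: "table \<Rightarrow> ref \<Rightarrow> ref node" where
  "table_kind T (SinkRef b) = Sink b"
| "table_kind T (TableRef i) = (case T ! i of (x, low, high) \<Rightarrow> Decision x low high)"

definition returned_dag :: "table \<Rightarrow> ref \<Rightarrow> ref diagram" where
  "returned_dag T n =
     \<lparr>nodes = {v. (child (table_kind T))\<^sup>*\<^sup>* n v}, root = n, kind = table_kind T\<rparr>"

end

theory Submission
  imports Defs
begin

text \<open>
  A rooted DAG is compared with its unfolding into a tree. In a reduced diagram distinct nodes
  have distinct unfoldings, so two reduced diagrams with the same unfolding are isomorphic.
  The unique-nodes table stays reduced, and conditioning on \<open>x\<close> removes \<open>x\<close>, so every returned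
  DAG is a reduced FBDD. Conversely, let \<open>\<Delta>\<close> have one clause for each path from the root of a
  reduced FBDD to the 0-sink, namely the negation of the assignment made along the path. By the
  test-once property, conditioning on the root variable yields the CNF formulas of the children,
  so branching along the diagram rebuilds its unfolding. No call stops early, because in a reduced
  diagram every node other than the 1-sink has a path to the 0-sink.
\<close>

section \<open>Unfoldings\<close>

text \<open>Trees carry no node identities, so diagrams over different node types can be compared
  through one common value.\<close>

datatype dtree = Leaf bool | Branch var dtree dtree

primrec labels :: "dtree \<Rightarrow> var set" where
  "labels (Leaf b) = {}"
| "labels (Branch x l h) = insert x (labels l \<union> labels h)"

primrec read_once :: "dtree \<Rightarrow> bool" where
  "read_once (Leaf b) \<longleftrightarrow> True"
| "read_once (Branch x l h) \<longleftrightarrow> x \<notin> labels l \<and> x \<notin> labels h \<and> read_once l \<and> read_once h"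

text \<open>Tree counterpart of reduction rule (b). Here children are compared as trees, whereas
  \<open>reduced\<close> compares them as nodes.\<close>

primrec irredundant :: "dtree \<Rightarrow> bool" where
  "irredundant (Leaf b) \<longleftrightarrow> True"
| "irredundant (Branch x l h) \<longleftrightarrow> l \<noteq> h \<and> irredundant l \<and> irredundant h"

text \<open>A relation instead of a recursive function: an arbitrary \<open>k\<close> may have
  cycles, and only nodes whose unfolding is finite are related to a tree.\<close>

inductive unfolds :: "('n \<Rightarrow> 'n node) \<Rightarrow> 'n \<Rightarrow> dtree \<Rightarrow> bool" for k where
  leaf: "k u = Sink b \<Longrightarrow> unfolds k u (Leaf b)"
| branch: "k u = Decision x l h \<Longrightarrow> unfolds k l s \<Longrightarrow> unfolds k h t \<Longrightarrow> unfolds k u (Branch x s t)"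

inductive_cases unfolds_LeafE: "unfolds k u (Leaf b)"
inductive_cases unfolds_BranchE: "unfolds k u (Branch x s t)"

lemma child_simps:
  "k u = Sink b \<Longrightarrow> \<not> child k u v"
  "k u = Decision x l h \<Longrightarrow> child k u v \<longleftrightarrow> v = l \<or> v = h"
  by (auto simp: child_def)

lemma unfolds_unique: "unfolds k u s \<Longrightarrow> unfolds k u t \<Longrightarrow> s = t"
proof (induction arbitrary: t rule: unfolds.induct)
  case (leaf u b)
  from leaf.prems show ?case by cases (use leaf.hyps in simp_all)
next
  case (branch u x l h s s')
  obtain r r' where "unfolds k l r" "unfolds k h r'" "t = Branch x r r'"
    using branch.prems by cases (use branch.hyps(1) in auto)
  then show ?case using branch.IH by blast
qed

text \<open>Nodes are merged from the leaves upwards: equal subtrees identify the children, so the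
  two kinds agree, and \<open>k\<close> is injective on \<open>N\<close>. Closure of
  \<open>N\<close> under children lets the induction descend.\<close>

lemma unfolds_inj:
  assumes "unfolds k u t" "unfolds k v t" "u \<in> N" "v \<in> N"
    and closed: "\<And>u v. u \<in> N \<Longrightarrow> child k u v \<Longrightarrow> v \<in> N"
    and inj: "\<And>u v. u \<in> N \<Longrightarrow> v \<in> N \<Longrightarrow> k u = k v \<Longrightarrow> u = v"
  shows "u = v"
  using assms(1-4)
proof (induction t arbitrary: u v rule: dtree.induct)
  case (Leaf b)
  then show ?case by (auto elim!: unfolds_LeafE intro: inj)
next
  case (Branch x s t)
  from Branch.prems(1) obtain l h where u: "k u = Decision x l h" "unfolds k l s" "unfolds k h t"
    by (rule unfolds_BranchE)
  from Branch.prems(2) obtain l' h' where v: "k v = Decision x l' h'" "unfolds k l' s" "unfolds k h' t"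
    by (rule unfolds_BranchE)
  have "{l, h, l', h'} \<subseteq> N"
    using closed Branch.prems(3,4) u(1) v(1) by (auto simp: child_simps)
  then have "l = l'" "h = h'"
    using Branch.IH u v by auto
  then show ?case
    using inj Branch.prems(3,4) u(1) v(1) by simp
qed

text \<open>A path from \<open>u\<close> can be copied edge by edge from \<open>u'\<close>, taking
  the low or high child in both diagrams alike, with a common unfolding kept at every step.\<close>

lemma unfolds_reachable:
  assumes "(child k)\<^sup>*\<^sup>* u v" "unfolds k u t" "unfolds k' u' t"
  shows "\<exists>v' s. (child k')\<^sup>*\<^sup>* u' v' \<and> unfolds k v s \<and> unfolds k' v' s"
  using assms(1)
proof (induction rule: rtranclp_induct)
  case base
  then show ?case using assms by blast
next
  case (step v w)
  then obtain v' s where v': "(child k')\<^sup>*\<^sup>* u' v'" "unfolds k v s" "unfolds k' v' s"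
    by blast
  show ?case
  proof (cases s)
    case (Leaf b)
    then show ?thesis using v' step.hyps by (auto elim!: unfolds_LeafE simp: child_simps)
  next
    case (Branch x s1 s2)
    obtain l h where v: "k v = Decision x l h" "unfolds k l s1" "unfolds k h s2"
      using v'(2) Branch by (auto elim: unfolds_BranchE)
    obtain l' h' where w: "k' v' = Decision x l' h'" "unfolds k' l' s1" "unfolds k' h' s2"
      using v'(3) Branch by (auto elim: unfolds_BranchE)
    have "child k' v' l'" "child k' v' h'"
      using w by (auto simp: child_simps)
    then have "(child k')\<^sup>*\<^sup>* u' l'" "(child k')\<^sup>*\<^sup>* u' h'"
      using v'(1) by (auto intro: rtranclp.rtrancl_into_rtrancl)
    then show ?thesis
      using step.hyps(2) v w by (auto simp: child_simps)
  qed
qed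

section \<open>Diagrams and their unfoldings\<close>

lemma decision_diagramD:
  assumes "decision_diagram G"
  shows "finite (nodes G)" "root G \<in> nodes G" "u \<in> nodes G \<Longrightarrow> child (kind G) u v \<Longrightarrow> v \<in> nodes G"
    "acyclic {(u, v). u \<in> nodes G \<and> child (kind G) u v}"
    "v \<in> nodes G \<Longrightarrow> (child (kind G))\<^sup>*\<^sup>* (root G) v"
  using assms unfolding decision_diagram_def by blast+

lemma decision_diagram_Decision:
  assumes "decision_diagram G" "u \<in> nodes G" "kind G u = Decision x l h"
  shows "l \<in> nodes G" "h \<in> nodes G"
  using assms decision_diagramD(3) by (fastforce simp: child_simps)+

lemma reducedD:
  assumes "reduced G"
  shows "u \<in> nodes G \<Longrightarrow> v \<in> nodes G \<Longrightarrow> kind G u = kind G v \<Longrightarrow> u = v"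
    "u \<in> nodes G \<Longrightarrow> kind G u = Decision x l h \<Longrightarrow> l \<noteq> h"
  using assms unfolding reduced_def by blast+

lemma unfolds_inj_reduced:
  assumes "decision_diagram G" "reduced G"
    and "unfolds (kind G) u t" "unfolds (kind G) v t" "u \<in> nodes G" "v \<in> nodes G"
  shows "u = v"
  by (rule unfolds_inj[OF assms(3-6) decision_diagramD(3)[OF assms(1)] reducedD(1)[OF assms(2)]])

lemma decision_diagram_nodes:
  assumes "decision_diagram G"
  shows "nodes G = {v. (child (kind G))\<^sup>*\<^sup>* (root G) v}"
proof -
  have "v \<in> nodes G" if "(child (kind G))\<^sup>*\<^sup>* (root G) v" for v
    using that by (induction rule: rtranclp_induct) (blast intro: decision_diagramD[OF assms])+
  then show ?thesis
    using decision_diagramD(5)[OF assms] by blast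
qed

text \<open>In a finite acyclic graph the converse edge relation is well-founded, so the tree can be
  built from the sinks towards the root.\<close>

lemma decision_diagram_unfolds:
  assumes G: "decision_diagram G" and "u \<in> nodes G"
  shows "\<exists>t. unfolds (kind G) u t"
proof -
  let ?E = "{(u, v). u \<in> nodes G \<and> child (kind G) u v}"
  have "?E \<subseteq> nodes G \<times> nodes G"
    using decision_diagramD(3)[OF G] by blast
  then have "finite ?E"
    using decision_diagramD(1)[OF G] by (meson finite_SigmaI finite_subset)
  then have "wf (?E\<inverse>)"
    using decision_diagramD(4)[OF G] by (rule finite_acyclic_wf_converse)
  then show ?thesis
    using \<open>u \<in> nodes G\<close>
  proof (induction u rule: wf_induct_rule)
    case (less u)
    show ?case
    proof (cases "kind G u")
      case (Sink b)
      then show ?thesis by (blast intro: unfolds.leaf)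
    next
      case (Decision x l h)
      then have "l \<in> nodes G" "h \<in> nodes G"
        using decision_diagram_Decision[OF G less.prems] by auto
      moreover have "(l, u) \<in> ?E\<inverse>" "(h, u) \<in> ?E\<inverse>"
        using less.prems Decision by (auto simp: child_simps)
      ultimately obtain s t where "unfolds (kind G) l s" "unfolds (kind G) h t"
        using less.IH by blast
      then show ?thesis
        using Decision by (blast intro: unfolds.branch)
    qed
  qed
qed

text \<open>The relation \<open>R\<close> of having the same unfolding is total in both directions
  because all nodes are reachable, and single-valued in both directions because both diagrams are
  reduced. Hence it is the graph of a bijection.\<close>

lemma isomorphic_if_unfolds:
  assumes G: "decision_diagram G" "reduced G" and H: "decision_diagram H" "reduced H"
    and t: "unfolds (kind G) (root G) t" "unfolds (kind H) (root H) t"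
  shows "isomorphic G H"
proof -
  define R where "R u v \<longleftrightarrow> (\<exists>s. unfolds (kind G) u s \<and> unfolds (kind H) v s)" for u v
  have totalG: "\<exists>v\<in>nodes H. R u v" if "u \<in> nodes G" for u
    using that unfolds_reachable[OF _ t] unfolding R_def
      decision_diagram_nodes[OF G(1)] decision_diagram_nodes[OF H(1)] by blast
  have totalH: "\<exists>u\<in>nodes G. R u v" if "v \<in> nodes H" for v
    using that unfolds_reachable[OF _ t(2,1)] unfolding R_def
      decision_diagram_nodes[OF G(1)] decision_diagram_nodes[OF H(1)] by blast
  have uniqueH: "v = v'" if "R u v" "R u v'" "v \<in> nodes H" "v' \<in> nodes H" for u v v'
    using that unfolds_inj_reduced[OF H] unfolds_unique unfolding R_def by metis
  have uniqueG: "u = u'" if "R u v" "R u' v" "u \<in> nodes G" "u' \<in> nodes G" for u u' v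
    using that unfolds_inj_reduced[OF G] unfolds_unique unfolding R_def by metis
  obtain f where f: "\<And>u. u \<in> nodes G \<Longrightarrow> f u \<in> nodes H \<and> R u (f u)"
    using totalG by metis
  have f_eq: "f u = v" if "u \<in> nodes G" "v \<in> nodes H" "R u v" for u v
    using that f uniqueH by blast
  have "inj_on f (nodes G)"
    by (rule inj_onI) (metis f uniqueG)
  moreover have "f ` nodes G = nodes H"
  proof
    show "f ` nodes G \<subseteq> nodes H" using f by auto
    show "nodes H \<subseteq> f ` nodes G"
    proof
      fix v assume v: "v \<in> nodes H"
      then obtain u where "u \<in> nodes G" "R u v" using totalH by blast
      then show "v \<in> f ` nodes G" using f_eq[OF _ v] by (intro image_eqI[of _ _ u]) simp_all
    qed
  qed
  moreover have "f (root G) = root H"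
    using f_eq[OF decision_diagramD(2)[OF G(1)] decision_diagramD(2)[OF H(1)]] t
    unfolding R_def by blast
  moreover have "kind H (f u) = map_node f (kind G u)" if u: "u \<in> nodes G" for u
  proof -
    obtain s where s: "unfolds (kind G) u s" "unfolds (kind H) (f u) s"
      using f[OF u] by (auto simp: R_def)
    show ?thesis
    proof (cases s)
      case (Leaf b)
      then show ?thesis using s by (auto elim!: unfolds_LeafE)
    next
      case (Branch x s1 s2)
      obtain l h where l: "kind G u = Decision x l h" "unfolds (kind G) l s1" "unfolds (kind G) h s2"
        using s(1) Branch by (auto elim: unfolds_BranchE)
      obtain l' h' where l': "kind H (f u) = Decision x l' h'" "unfolds (kind H) l' s1" "unfolds (kind H) h' s2"
        using s(2) Branch by (auto elim: unfolds_BranchE)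
      have "l \<in> nodes G" "h \<in> nodes G"
        using decision_diagram_Decision[OF G(1) u l(1)] by auto
      moreover have "l' \<in> nodes H" "h' \<in> nodes H"
        using decision_diagram_Decision[OF H(1) _ l'(1)] f[OF u] by auto
      \<comment> \<open>Corresponding children share the unfoldings \<open>s1\<close> and
        \<open>s2\<close>, so \<open>R\<close> relates them and \<open>f\<close> has to map one to
        the other.\<close>
      ultimately have "f l = l'" "f h = h'"
        using l l' by (metis f_eq R_def)+
      then show ?thesis using l l' by simp
    qed
  qed
  ultimately show ?thesis
    unfolding isomorphic_def bij_betw_def by blast
qed

text \<open>Distinct nodes of a reduced diagram unfold to distinct trees, which carries rule (b)
  over from nodes to trees.\<close>

lemma irredundant_if_reduced:
  assumes G: "decision_diagram G" "reduced G"
    and "unfolds (kind G) u t" "u \<in> nodes G"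
  shows "irredundant t"
  using assms(3,4)
proof (induction rule: unfolds.induct)
  case (branch u x l h s t)
  have lh: "l \<in> nodes G" "h \<in> nodes G"
    using decision_diagram_Decision[OF G(1) branch.prems branch.hyps(1)] by auto
  have "l \<noteq> h"
    using reducedD(2)[OF G(2) branch.prems branch.hyps(1)] .
  have "s \<noteq> t"
  proof
    assume "s = t"
    then have "l = h"
      using unfolds_inj_reduced[OF G] branch.hyps lh by blast
    then show False using \<open>l \<noteq> h\<close> by simp
  qed
  then show ?case using branch.IH lh by simp
qed simp

section \<open>The test-once property\<close>

text \<open>Generalizes \<open>root_sink_path\<close> to an arbitrary starting node, so that paths
  can be prolonged backwards one edge at a time.\<close>

definition sink_path :: "('n \<Rightarrow> 'n node) \<Rightarrow> 'n \<Rightarrow> 'n list \<Rightarrow> bool" where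
  "sink_path k u p \<longleftrightarrow>
     p \<noteq> [] \<and> hd p = u \<and> successively (child k) p \<and> (\<exists>b. k (last p) = Sink b)"

lemma sink_path_Cons: "child k u v \<Longrightarrow> sink_path k v p \<Longrightarrow> sink_path k u (u # p)"
  by (cases p) (auto simp: sink_path_def)

lemma sink_path_extend:
  "(child k)\<^sup>*\<^sup>* u v \<Longrightarrow> sink_path k v p \<Longrightarrow> \<exists>q. sink_path k u q \<and> set p \<subseteq> set q"
proof (induction rule: converse_rtranclp_induct)
  case (step u w)
  then obtain q where "sink_path k w q" "set p \<subseteq> set q" by blast
  then show ?case
    using sink_path_Cons[OF step.hyps(1)] by (intro exI[of _ "u # q"]) auto
qed blast

lemma unfolds_sink_path: "unfolds k u t \<Longrightarrow> \<exists>p. sink_path k u p"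
proof (induction rule: unfolds.induct)
  case (leaf u b)
  then have "sink_path k u [u]" by (simp add: sink_path_def)
  then show ?case by blast
next
  case (branch u x l h s t)
  then show ?case using sink_path_Cons[of k u l] by (auto simp: child_simps)
qed

text \<open>The size bound serves to show later that the node found below \<open>u\<close> is not an
  ancestor of \<open>u\<close>, whose unfolding would be larger.\<close>

lemma labels_reachable:
  "unfolds k u t \<Longrightarrow> x \<in> labels t \<Longrightarrow>
    \<exists>v l h s. (child k)\<^sup>*\<^sup>* u v \<and> k v = Decision x l h \<and> unfolds k v s \<and> size s \<le> size t"
proof (induction rule: unfolds.induct)
  case (branch u y l h s t)
  have u: "child k u l" "child k u h" "unfolds k u (Branch y s t)"
    using branch by (auto simp: child_simps intro: unfolds.branch)
  consider "x = y" | "x \<in> labels s" | "x \<in> labels t"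
    using branch.prems by auto
  then show ?case
  proof cases
    case 1
    then show ?thesis using u(3) branch.hyps(1) by blast
  next
    case 2
    then obtain v l' h' s' where "(child k)\<^sup>*\<^sup>* l v" "k v = Decision x l' h'" "unfolds k v s'" "size s' \<le> size s"
      using branch.IH by blast
    moreover from this have "(child k)\<^sup>*\<^sup>* u v" "size s' \<le> size (Branch y s t)"
      using u by (auto intro: converse_rtranclp_into_rtranclp)
    ultimately show ?thesis by blast
  next
    case 3
    then obtain v l' h' s' where "(child k)\<^sup>*\<^sup>* h v" "k v = Decision x l' h'" "unfolds k v s'" "size s' \<le> size t"
      using branch.IH by blast
    moreover from this have "(child k)\<^sup>*\<^sup>* u v" "size s' \<le> size (Branch y s t)"
      using u by (auto intro: converse_rtranclp_into_rtranclp)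
    ultimately show ?thesis by blast
  qed
qed simp

lemma fbddD:
  assumes "fbdd G"
  shows "decision_diagram G"
    "root_sink_path G p \<Longrightarrow> u \<in> set p \<Longrightarrow> v \<in> set p \<Longrightarrow>
      kind G u = Decision x l h \<Longrightarrow> kind G v = Decision x l' h' \<Longrightarrow> u = v"
  using assms unfolding fbdd_def by blast+

text \<open>A second test of \<open>x\<close> at some \<open>w\<close> below \<open>v\<close> would
  lie on a root-to-sink path through \<open>u\<close>. The test-once property then gives
  \<open>w = u\<close>, although the unfolding of \<open>w\<close> is smaller than that of
  \<open>u\<close>.\<close>

lemma fbdd_child_labels:
  assumes G: "fbdd G" and u: "u \<in> nodes G" "kind G u = Decision x l h" "unfolds (kind G) u t"
    and v: "child (kind G) u v" "unfolds (kind G) v s" "size s < size t"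
  shows "x \<notin> labels s"
proof
  let ?k = "kind G"
  assume "x \<in> labels s"
  then obtain w l' h' r where w: "(child ?k)\<^sup>*\<^sup>* v w" "?k w = Decision x l' h'" "unfolds ?k w r" "size r \<le> size s"
    using labels_reachable[OF v(2)] by blast
  obtain p0 where p0: "sink_path ?k w p0"
    using unfolds_sink_path[OF w(3)] by blast
  then obtain p where p: "sink_path ?k v p" "set p0 \<subseteq> set p"
    using sink_path_extend[OF w(1) p0] by blast
  have "w \<in> set p0"
    using p0 by (auto simp: sink_path_def)
  have u_root: "(child ?k)\<^sup>*\<^sup>* (root G) u"
    using decision_diagramD(5)[OF fbddD(1)[OF G] u(1)] .
  \<comment> \<open>The test-once property speaks of complete paths only, so the piece from
    \<open>u\<close> through \<open>w\<close> to a sink is prolonged back to the root.\<close>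
  then obtain q where q: "sink_path ?k (root G) q" "set (u # p) \<subseteq> set q"
    using sink_path_extend[OF u_root sink_path_Cons[OF v(1) p(1)]] by blast
  have "w \<in> set q" "u \<in> set q"
    using q p \<open>w \<in> set p0\<close> by auto
  moreover have "root_sink_path G q"
    using q(1) by (simp add: sink_path_def root_sink_path_def)
  ultimately have "w = u"
    using fbddD(2)[OF G _ _ _ w(2) u(2)] by blast
  then have "r = t"
    using w(3) u(3) unfolds_unique by metis
  then show False
    using w(4) v(3) by simp
qed

lemma read_once_if_fbdd:
  assumes G: "fbdd G" and "unfolds (kind G) u t" "u \<in> nodes G"
  shows "read_once t"
  using assms(2,3)
proof (induction rule: unfolds.induct)
  case (branch u x l h s t)
  have "child (kind G) u l" "child (kind G) u h"
    using branch.hyps by (auto simp: child_simps)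
  moreover have "l \<in> nodes G" "h \<in> nodes G"
    using decision_diagram_Decision[OF fbddD(1)[OF G] branch.prems branch.hyps(1)] by simp_all
  moreover have "unfolds (kind G) u (Branch x s t)"
    using branch.hyps by (rule unfolds.branch)
  ultimately show ?case
    using fbdd_child_labels[OF G branch.prems branch.hyps(1)] branch.hyps branch.IH by simp
qed simp

text \<open>Following the path in the diagram means descending in the tree: the tail starts at a
  child, whose unfolding is a subtree of \<open>t\<close>.\<close>

lemma path_labels:
  assumes "unfolds k u t" "successively (child k) p" "p \<noteq> []" "hd p = u"
    "v \<in> set p" "k v = Decision x l h"
  shows "x \<in> labels t"
  using assms
proof (induction p arbitrary: u t rule: list.induct)
  case (Cons a p)
  show ?case
    using Cons.prems(1)
  proof cases
    case (leaf b)
    then show ?thesis using Cons.prems by (cases p) (auto simp: child_simps)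
  next
    case (branch y l' h' s s')
    show ?thesis
    proof (cases "v = a")
      case True
      then show ?thesis using branch Cons.prems by auto
    next
      case False
      then have "v \<in> set p" "p \<noteq> []" using Cons.prems by auto
      moreover from this have "successively (child k) p" "hd p = l' \<or> hd p = h'"
        using Cons.prems branch by (cases p; auto simp: child_simps)+
      ultimately have "x \<in> labels s \<or> x \<in> labels s'"
        using Cons.IH branch Cons.prems(6) by metis
      then show ?thesis using branch by auto
    qed
  qed
qed simp

text \<open>The label of the first node does not occur in the unfolding of the next node, so no
  later node on the path repeats it. The remaining pairs lie in the tail, where induction
  applies.\<close>

lemma read_once_path:
  assumes "unfolds k u t" "read_once t" "successively (child k) p" "p \<noteq> []" "hd p = u"
    "v \<in> set p" "w \<in> set p" "k v = Decision x l h" "k w = Decision x l' h'"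
  shows "v = w"
  using assms
proof (induction p arbitrary: u t rule: list.induct)
  case (Cons a p)
  show ?case
    using Cons.prems(1)
  proof cases
    case (leaf b)
    then show ?thesis using Cons.prems by (cases p) (auto simp: child_simps)
  next
    case (branch y l1 h1 s1 s2)
    show ?thesis
    proof (cases "p = []")
      case True
      then show ?thesis using Cons.prems by simp
    next
      case False
      then have p: "successively (child k) p" "hd p = l1 \<or> hd p = h1"
        using Cons.prems branch by (cases p; auto simp: child_simps)+
      then obtain s where s: "unfolds k (hd p) s" "y \<notin> labels s" "read_once s"
        using branch Cons.prems(2) by auto
      have "y \<noteq> x" if "z \<in> set p" "k z = Decision x l2 h2" for z l2 h2
        using path_labels[OF s(1) p(1) False refl that] s(2) by auto
      moreover have "x = y" if "a = v \<or> a = w"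
        using that branch Cons.prems by auto
      \<comment> \<open>If exactly one of \<open>v\<close> and \<open>w\<close> were the head, the
        other would be a later node with the label \<open>y\<close> of the head.\<close>
      ultimately have "v = w \<or> v \<in> set p \<and> w \<in> set p"
        using Cons.prems by auto
      then show ?thesis
        using Cons.IH[OF s(1,3) p(1) False refl] Cons.prems by blast
    qed
  qed
qed simp

lemma fbdd_if_read_once:
  assumes "decision_diagram G" "unfolds (kind G) (root G) t" "read_once t"
  shows "fbdd G"
  unfolding fbdd_def root_sink_path_def using assms read_once_path[OF assms(2,3)] by blast

section \<open>The unique-nodes table\<close>

fun valid_ref :: "nat \<Rightarrow> ref \<Rightarrow> bool" where
  "valid_ref m (SinkRef b) \<longleftrightarrow> True"
| "valid_ref m (TableRef i) \<longleftrightarrow> i < m"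

text \<open>The bound \<open>i\<close> for the children of entry \<open>i\<close> says that they
  refer to sinks or to entries created earlier, which yields acyclicity. Distinctness of the entries
  is the uniqueness of decision nodes.\<close>

definition valid_table :: "table \<Rightarrow> bool" where
  "valid_table T \<longleftrightarrow> distinct T \<and>
     (\<forall>i<length T. \<forall>x l h. T ! i = (x, l, h) \<longrightarrow> l \<noteq> h \<and> valid_ref i l \<and> valid_ref i h)"

lemma valid_ref_mono: "valid_ref m r \<Longrightarrow> m \<le> m' \<Longrightarrow> valid_ref m' r"
  by (cases r) auto

lemma valid_table_Nil: "valid_table []"
  by (simp add: valid_table_def)

lemma valid_table_snoc:
  assumes "valid_table T" "l \<noteq> h" "valid_ref (length T) l" "valid_ref (length T) h" "(x, l, h) \<notin> set T"
  shows "valid_table (T @ [(x, l, h)])"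
  using assms by (auto simp: valid_table_def nth_append less_Suc_eq)

lemma table_kind_Decision:
  assumes "valid_table T" "valid_ref (length T) r" "table_kind T r = Decision x l h"
  obtains i where "r = TableRef i" "i < length T" "T ! i = (x, l, h)" "l \<noteq> h" "valid_ref i l" "valid_ref i h"
  using assms by (cases r) (auto simp: valid_table_def split: prod.splits)

lemma valid_ref_child:
  assumes "valid_table T" "valid_ref (length T) u" "child (table_kind T) u v"
  shows "valid_ref (length T) v"
  using assms unfolding child_def
  by (metis table_kind_Decision valid_ref_mono less_imp_le)

lemma table_kind_append: "valid_ref (length T) r \<Longrightarrow> table_kind (T @ E) r = table_kind T r"
  by (cases r) (auto simp: nth_append)

text \<open>Existing entries never change and refer only to existing entries, so results of earlier
  calls keep their meaning while later calls enlarge the table.\<close>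

lemma unfolds_append:
  assumes "valid_table T" "unfolds (table_kind T) r t" "valid_ref (length T) r"
  shows "unfolds (table_kind (T @ E)) r t"
  using assms(2,3)
proof (induction rule: unfolds.induct)
  case (leaf u b)
  then show ?case by (simp add: table_kind_append unfolds.leaf)
next
  case (branch u x l h s t)
  have "valid_ref (length T) l" "valid_ref (length T) h"
    using valid_ref_child[OF assms(1)] branch by (auto simp: child_simps)
  then show ?case
    using branch by (auto simp: table_kind_append intro: unfolds.branch)
qed

text \<open>The cases \<open>found\<close> and \<open>fresh\<close> are merged: in both, the
  resulting table holds the required decision node at the returned reference.\<close>

lemma get_node_valid:
  assumes "get_node x l h T r T'" "valid_table T" "valid_ref (length T) l" "valid_ref (length T) h"
  shows "\<exists>E. T' = T @ E \<and> valid_table T' \<and> valid_ref (length T') r \<and>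
    (l = h \<and> r = l \<or> l \<noteq> h \<and> table_kind T' r = Decision x l h)"
  using assms by cases (auto simp: valid_table_snoc)

lemma get_node_total: "\<exists>r T'. get_node x l h T r T'"
  by (metis get_node.intros in_set_conv_nth)

text \<open>Every edge leads to an older entry or to a sink, which excludes cycles. Distinct entries
  have distinct kinds, as do the two sinks, and no entry has equal children.\<close>

lemma returned_dag_valid:
  assumes T: "valid_table T" and n: "valid_ref (length T) n"
  shows "decision_diagram (returned_dag T n)" "reduced (returned_dag T n)"
proof -
  define k where "k = table_kind T"
  define N where "N = {v. (child k)\<^sup>*\<^sup>* n v}"
  have dag: "returned_dag T n = \<lparr>nodes = N, root = n, kind = k\<rparr>"
    by (simp add: returned_dag_def N_def k_def)
  have valid: "valid_ref (length T) v" if "v \<in> N" for v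
  proof -
    have "(child k)\<^sup>*\<^sup>* n v" using that by (simp add: N_def)
    then show ?thesis
      by (induction rule: rtranclp_induct) (use n valid_ref_child[OF T] k_def in auto)
  qed
  have "N \<subseteq> range SinkRef \<union> TableRef ` {..<length T}"
  proof
    fix v assume "v \<in> N"
    then show "v \<in> range SinkRef \<union> TableRef ` {..<length T}"
      using valid[of v] by (cases v) auto
  qed
  then have fin: "finite N"
    by (rule finite_subset) auto
  \<comment> \<open>The successor keeps the sinks, of rank 0, strictly below the table entry with
    index 0.\<close>
  define rank where "rank r = (case r of SinkRef b \<Rightarrow> 0 | TableRef i \<Rightarrow> Suc i)" for r
  have rank_valid: "rank r < Suc i" if "valid_ref i r" for i r
    using that by (cases r) (auto simp: rank_def)
  have "rank v < rank u" if "u \<in> N" "child k u v" for u v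
  proof -
    obtain x l h where u: "k u = Decision x l h" "v = l \<or> v = h"
      using \<open>child k u v\<close> by (auto simp: child_def)
    obtain i where "u = TableRef i" "valid_ref i l" "valid_ref i h"
      using table_kind_Decision[OF T valid[OF \<open>u \<in> N\<close>]] u(1) unfolding k_def by metis
    then show ?thesis using u(2) rank_valid by (auto simp: rank_def)
  qed
  then have "{(u, v). u \<in> N \<and> child k u v}\<inverse> \<subseteq> measure rank"
    by auto
  then have "acyclic ({(u, v). u \<in> N \<and> child k u v}\<inverse>)"
    by (rule acyclic_subset[OF wf_acyclic[OF wf_measure]])
  then have acyc: "acyclic {(u, v). u \<in> N \<and> child k u v}"
    by (simp only: acyclic_converse)
  show "decision_diagram (returned_dag T n)"
    unfolding dag decision_diagram_def using fin acyc
    by (auto simp: N_def intro: rtranclp.rtrancl_into_rtrancl)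
  have "u = v" if uv: "u \<in> N" "v \<in> N" "k u = k v" for u v
  proof (cases "k u")
    case (Sink b)
    then show ?thesis using uv(3) unfolding k_def by (cases u; cases v) (auto split: prod.splits)
  next
    case (Decision x l h)
    obtain i where "u = TableRef i" "i < length T" "T ! i = (x, l, h)"
      using table_kind_Decision[OF T valid[OF uv(1)]] Decision unfolding k_def by metis
    moreover obtain j where "v = TableRef j" "j < length T" "T ! j = (x, l, h)"
      using table_kind_Decision[OF T valid[OF uv(2)]] Decision uv(3) unfolding k_def by metis
    moreover have "distinct T"
      using T by (simp add: valid_table_def)
    ultimately show ?thesis
      by (metis nth_eq_iff_index_eq)
  qed
  moreover have "l \<noteq> h" if "u \<in> N" "k u = Decision x l h" for u x l h
    using table_kind_Decision[OF T valid[OF that(1)]] that(2) unfolding k_def by metis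
  ultimately show "reduced (returned_dag T n)"
    unfolding dag reduced_def diagram.select_convs by blast
qed

section \<open>Executions\<close>

text \<open>Clauses with the true literal over \<open>x\<close> are dropped, and the false one is
  deleted from the others.\<close>

lemma vars_condition: "vars (condition \<Delta> x b) \<subseteq> vars \<Delta> - {x}"
  by (cases b) (auto simp: vars_def condition_def true_lit_def)

text \<open>The bound on the labels is what makes the tree read-once: both recursive calls work on
  formulas without \<open>x\<close>, so \<open>x\<close> labels no node below a new decision on
  \<open>x\<close>. The initial table is arbitrary because the recursive calls share it.\<close>

lemma dpll_f_invariant:
  assumes "dpll_f \<Delta> T n T'" "valid_table T"
  shows "\<exists>E t. T' = T @ E \<and> valid_table T' \<and> valid_ref (length T') n \<and>
    unfolds (table_kind T') n t \<and> read_once t \<and> labels t \<subseteq> vars \<Delta>"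
  using assms
proof (induction rule: dpll_f.induct)
  case (unsat \<Delta> T)
  then show ?case by (auto intro!: exI[of _ "Leaf False"] unfolds.leaf)
next
  case (sat \<Delta> T)
  then show ?case by (auto intro!: exI[of _ "Leaf True"] unfolds.leaf)
next
  case (branch \<Delta> x T low T1 high T2 n T3)
  obtain E1 s where 1: "T1 = T @ E1" "valid_table T1" "valid_ref (length T1) low"
    "unfolds (table_kind T1) low s" "read_once s" "labels s \<subseteq> vars (condition \<Delta> x False)"
    using branch by blast
  obtain E2 t where 2: "T2 = T1 @ E2" "valid_table T2" "valid_ref (length T2) high"
    "unfolds (table_kind T2) high t" "read_once t" "labels t \<subseteq> vars (condition \<Delta> x True)"
    using branch 1(2) by blast
  \<comment> \<open>The low result was obtained for \<open>T1\<close> and has to be carried over to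
    the table left by the high call.\<close>
  have low2: "valid_ref (length T2) low" "unfolds (table_kind T2) low s"
    using valid_ref_mono[OF 1(3)] unfolds_append[OF 1(2,4,3)] 2(1) by auto
  obtain E3 where 3: "T3 = T2 @ E3" "valid_table T3" "valid_ref (length T3) n"
    "low = high \<and> n = low \<or> low \<noteq> high \<and> table_kind T3 n = Decision x low high"
    using get_node_valid[OF branch.hyps(5) 2(2) low2(1) 2(3)] by blast
  have u: "unfolds (table_kind T3) low s" "unfolds (table_kind T3) high t"
    using unfolds_append[OF 2(2) low2(2,1)] unfolds_append[OF 2(2,4,3)] 3(1) by auto
  have lab: "labels s \<subseteq> vars \<Delta> - {x}" "labels t \<subseteq> vars \<Delta> - {x}"
    using 1(6) 2(6) vars_condition[of \<Delta> x] by blast+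
  have "\<exists>r. unfolds (table_kind T3) n r \<and> read_once r \<and> labels r \<subseteq> vars \<Delta>"
  \<comment> \<open>If the children coincide, \<open>get_node\<close> returns the child itself and
    its tree \<open>s\<close> is the witness.\<close>
  proof (cases "low = high")
    case True
    then show ?thesis using 3(4) u(1) lab 1(5) by blast
  next
    case False
    then have "unfolds (table_kind T3) n (Branch x s t)"
      using 3(4) u by (auto intro: unfolds.branch)
    moreover have "read_once (Branch x s t)" "labels (Branch x s t) \<subseteq> vars \<Delta>"
      using lab 1(5) 2(5) branch.hyps(2) by auto
    ultimately show ?thesis by blast
  qed
  then show ?case using 1(1) 2(1) 3(1-3) by auto
qed

text \<open>Each clause excludes one path to a false leaf. The low branch assumes that
  \<open>x\<close> is false, so the clauses excluding its paths receive the positive literal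
  \<open>Pos x\<close>, and dually for the high branch.\<close>

primrec cnf_of :: "dtree \<Rightarrow> clause set" where
  "cnf_of (Leaf b) = (if b then {} else {{}})"
| "cnf_of (Branch x l h) = insert (Pos x) ` cnf_of l \<union> insert (Neg x) ` cnf_of h"

lemma is_cnf_cnf_of: "is_cnf (cnf_of t)"
  by (induction t) (auto simp: is_cnf_def)

lemma vars_cnf_of: "vars (cnf_of t) \<subseteq> labels t"
  by (induction t) (auto simp: vars_def)

text \<open>The children of an irredundant branch differ, so one of them is not the true leaf and
  contributes a clause by induction. This guarantees that the root variable occurs in the
  formula.\<close>

lemma cnf_of_nonempty: "irredundant t \<Longrightarrow> t \<noteq> Leaf True \<Longrightarrow> cnf_of t \<noteq> {}"
proof (induction t)
  case (Branch x l h)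
  then have "l \<noteq> Leaf True \<or> h \<noteq> Leaf True" by auto
  then show ?case using Branch by auto
qed simp

lemma image_insert_remove:
  assumes "\<And>C. C \<in> A \<Longrightarrow> a \<notin> C"
  shows "(\<lambda>C. C - {a}) ` insert a ` A = A"
  using assms by (auto simp: image_image)

text \<open>Setting \<open>x\<close> to false drops the clauses with \<open>Neg x\<close>, which are
  those from \<open>B\<close>, and deletes \<open>Pos x\<close> from the others. As \<open>x\<close>
  does not occur in \<open>A\<close>, this restores the clauses of \<open>A\<close> exactly. The
  other value is symmetric.\<close>

lemma condition_branch:
  assumes "x \<notin> vars A" "x \<notin> vars B"
  shows "condition (insert (Pos x) ` A \<union> insert (Neg x) ` B) x False = A"
    and "condition (insert (Pos x) ` A \<union> insert (Neg x) ` B) x True = B"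
proof -
  let ?F = "insert (Pos x) ` A \<union> insert (Neg x) ` B"
  have A: "Pos x \<notin> C" "Neg x \<notin> C" if "C \<in> A" for C
    using assms that by (auto simp: vars_def)
  have B: "Pos x \<notin> C" "Neg x \<notin> C" if "C \<in> B" for C
    using assms that by (auto simp: vars_def)
  have "{C \<in> ?F. Neg x \<notin> C} = insert (Pos x) ` A"
    using A by auto
  moreover have "condition ?F x False = (\<lambda>C. C - {Pos x}) ` {C \<in> ?F. Neg x \<notin> C}"
    by (auto simp: condition_def true_lit_def)
  ultimately show "condition ?F x False = A"
    using image_insert_remove[of A] A by simp
  have "{C \<in> ?F. Pos x \<notin> C} = insert (Neg x) ` B"
    using B by auto
  moreover have "condition ?F x True = (\<lambda>C. C - {Neg x}) ` {C \<in> ?F. Pos x \<notin> C}"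
    by (auto simp: condition_def true_lit_def)
  ultimately show "condition ?F x True = B"
    using image_insert_remove[of B] B by simp
qed

text \<open>The tree dictates the branching variables: after choosing the root label, the recursive
  calls receive exactly the formulas of the two subtrees.\<close>

lemma dpll_f_cnf_of:
  assumes "read_once t" "irredundant t" "valid_table T"
  shows "\<exists>n T'. dpll_f (cnf_of t) T n T' \<and> unfolds (table_kind T') n t"
  using assms
proof (induction t arbitrary: T)
  case (Leaf b)
  have "dpll_f (cnf_of (Leaf b)) T (SinkRef b) T"
    by (cases b) (auto intro: dpll_f.unsat dpll_f.sat simp: vars_def)
  moreover have "unfolds (table_kind T) (SinkRef b) (Leaf b)"
    by (simp add: unfolds.leaf)
  ultimately show ?case by blast
next
  case (Branch x s t)
  let ?\<Delta> = "cnf_of (Branch x s t)"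
  have "x \<notin> vars (cnf_of s)" "x \<notin> vars (cnf_of t)"
    using Branch.prems vars_cnf_of by auto
  note cond = condition_branch[OF this]
  \<comment> \<open>Every clause contains a literal over \<open>x\<close>, and at least one clause
    exists. This rules out both early returns and allows \<open>x\<close> to be selected.\<close>
  have "{} \<notin> ?\<Delta>" by auto
  have "?\<Delta> \<noteq> {}"
    by (rule cnf_of_nonempty) (use Branch.prems in auto)
  then have "x \<in> vars ?\<Delta>"
    by (auto simp: vars_def)
  obtain low T1 where low: "dpll_f (cnf_of s) T low T1" "unfolds (table_kind T1) low s"
    using Branch by fastforce
  obtain E1 where 1: "T1 = T @ E1" "valid_table T1" "valid_ref (length T1) low"
    using dpll_f_invariant[OF low(1) Branch.prems(3)] by blast
  obtain high T2 where high: "dpll_f (cnf_of t) T1 high T2" "unfolds (table_kind T2) high t"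
    using Branch 1(2) by fastforce
  obtain E2 where 2: "T2 = T1 @ E2" "valid_table T2" "valid_ref (length T2) high"
    using dpll_f_invariant[OF high(1) 1(2)] by blast
  have low2: "valid_ref (length T2) low" "unfolds (table_kind T2) low s"
    using valid_ref_mono[OF 1(3)] unfolds_append[OF 1(2) low(2) 1(3)] 2(1) by auto
  \<comment> \<open>One node cannot unfold to the different trees \<open>s\<close> and
    \<open>t\<close>. Hence \<open>get_node\<close> yields a decision on \<open>x\<close> and not
    merely a child.\<close>
  have "low \<noteq> high"
    using low2(2) high(2) unfolds_unique Branch.prems(2) by fastforce
  obtain n T3 where n: "get_node x low high T2 n T3"
    using get_node_total by blast
  obtain E3 where 3: "T3 = T2 @ E3" "table_kind T3 n = Decision x low high"
    using get_node_valid[OF n 2(2) low2(1) 2(3)] \<open>low \<noteq> high\<close> by blast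
  have "unfolds (table_kind T3) n (Branch x s t)"
    using unfolds_append[OF 2(2) low2(2,1)] unfolds_append[OF 2(2) high(2) 2(3)] 3
    by (auto intro: unfolds.branch)
  moreover have "dpll_f ?\<Delta> T n T3"
    by (rule dpll_f.branch[OF \<open>{} \<notin> ?\<Delta>\<close> \<open>x \<in> vars ?\<Delta>\<close> _ _ n])
      (use low(1) high(1) cond in simp_all)
  ultimately show ?case by blast
qed

section \<open>Executions from the empty table: soundness and completeness\<close>

lemma dpll_f_sound:
  assumes "dpll_f \<Delta> [] n T"
  shows "fbdd (returned_dag T n)" "reduced (returned_dag T n)"
proof -
  obtain t where t: "valid_table T" "valid_ref (length T) n" "unfolds (table_kind T) n t" "read_once t"
    using dpll_f_invariant[OF assms valid_table_Nil] by auto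
  show "reduced (returned_dag T n)"
    using returned_dag_valid t by blast
  show "fbdd (returned_dag T n)"
    by (rule fbdd_if_read_once[where t = t]) (use returned_dag_valid t in \<open>auto simp: returned_dag_def\<close>)
qed

text \<open>The tree \<open>t\<close> links the two diagrams: \<open>G\<close> unfolds to it and a
  suitable execution rebuilds it. Both diagrams are reduced, so the common unfolding determines them
  up to isomorphism.\<close>

lemma dpll_f_complete:
  fixes G :: "'n diagram"
  assumes G: "fbdd G" "reduced G"
  shows "\<exists>\<Delta> n T. is_cnf \<Delta> \<and> dpll_f \<Delta> [] n T \<and> isomorphic (returned_dag T n) G"
proof -
  have dd: "decision_diagram G" and root: "root G \<in> nodes G"
    using fbddD(1)[OF G(1)] decision_diagramD(2) by blast+
  obtain t where t: "unfolds (kind G) (root G) t"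
    using decision_diagram_unfolds[OF dd root] by blast
  have "read_once t" "irredundant t"
    using read_once_if_fbdd[OF G(1) t root] irredundant_if_reduced[OF dd G(2) t root] .
  then obtain n T where n: "dpll_f (cnf_of t) [] n T" "unfolds (table_kind T) n t"
    using dpll_f_cnf_of valid_table_Nil by blast
  have "isomorphic (returned_dag T n) G"
    by (rule isomorphic_if_unfolds[OF _ _ dd G(2) _ t])
      (use dpll_f_sound[OF n(1)] n(2) in \<open>simp_all add: fbddD(1) returned_dag_def\<close>)
  then show ?thesis using is_cnf_cnf_of n(1) by blast
qed

theorem theorem1:
  "(\<forall>\<Delta> n T. is_cnf \<Delta> \<and> dpll_f \<Delta> [] n T \<longrightarrow>
      fbdd (returned_dag T n) \<and> reduced (returned_dag T n)) \<and>
   (\<forall>G :: 'n diagram. fbdd G \<and> reduced G \<longrightarrow>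
      (\<exists>\<Delta> n T. is_cnf \<Delta> \<and> dpll_f \<Delta> [] n T \<and> isomorphic (returned_dag T n) G))"
  using dpll_f_sound dpll_f_complete by blast

end
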